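(* For every $p\le n$, the relation $\bar F\overset{p}{\sim}F$ is an equivalence relation on the set of Minkowski norms on $\mathbb{R}^n$.
   Context: A Minkowski norm on $\mathbb{R}^n$ ($n>1$) is a function $F:\mathbb{R}^n\to[0,\infty)$ that is $C^\infty$ on $\mathbb{R}^n\setminus\{0\}$, satisfies $F(\lambda y)=\lambda F(y)$ for $\lambda>0$, and such that for every $y\ne 0$ the symmetric bilinear form $g_y(u,v)=\frac12\frac{\partial^2}{\partial s\,\partial t}[F^2(y+su+tv)]_{|s=t=0}$ is positive definite. 1-forms on $\mathbb{R}^n$ are linear functionals. For a Minkowski norm $F$, a 1-form $\beta$ has norm $F(\beta)=\sup_{y\neq 0}|\beta(y)|/F(y)$. Given linearly independent 1-forms $\vec b=(\beta_1,\dots,\beta_q)$, $q\le n$ (the length of $\vec b$ is $q$), and a smooth function $\phi:\prod_{i=1}^q[-\delta_i,\delta_i]\to(0,\infty)$ with $F(\beta_i)<\delta_i$, the $T_{\vec b,\phi}$-deformation of $F$ is $T_{\vec b,\phi}(F)=F\cdot\phi(\beta_1/F,\dots,\beta_q/F)$. Standing assumption on deformations: $\phi-\sum_i s_i\,\partial\phi/\partial s_i>0$. For Minkowski norms $F,\bar F$ on $\mathbb{R}^n$ and $p\le n$, write $\bar F\overset{p}{\sim}F$ if there are finitely many deformations $T_{\vec b^i,\phi_i}$, $1\le i\le m$, with each $\vec b^i$ of length $\le p$, and Minkowski norms $F_0=F,F_1,\dots,F_m=\bar F$ such that $F_i=T_{\vec b^i,\phi_i}(F_{i-1})=F_{i-1}\,\phi_i(\vec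 b^i/F_{i-1})$ for $1\le i\le m$. *)

theory Defs
  imports "HOL-Analysis.Analysis"
begin

primrec Ck_on :: "nat \<Rightarrow> 'a::euclidean_space set \<Rightarrow> ('a \<Rightarrow> real) \<Rightarrow> bool" where
  "Ck_on 0 U f \<longleftrightarrow> continuous_on U f"
| "Ck_on (Suc k) U f \<longleftrightarrow> (\<forall>x\<in>U. f differentiable (at x)) \<and>
     (\<forall>v. Ck_on k U (\<lambda>x. frechet_derivative f (at x) v))"

text \<open>On a set that need not be open, smooth means: extends to a smooth function on an open
  neighbourhood. For open sets this is the usual notion.\<close>

definition smooth_on :: "'a::euclidean_space set \<Rightarrow> ('a \<Rightarrow> real) \<Rightarrow> bool" where
  "smooth_on A f \<longleftrightarrow>
     (\<exists>U h. open U \<and> A \<subseteq> U \<and> (\<forall>k. Ck_on k U h) \<and> (\<forall>x\<in>A. h x = f x))"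

definition fundamental_form ::
    "(real^'n \<Rightarrow> real) \<Rightarrow> real^'n \<Rightarrow> real^'n \<Rightarrow> real^'n \<Rightarrow> real" where
  "fundamental_form F y u v =
     1/2 * deriv (\<lambda>s. deriv (\<lambda>t. (F (y + s *\<^sub>R u + t *\<^sub>R v))\<^sup>2) 0) 0"

definition minkowski_norm :: "(real^'n \<Rightarrow> real) \<Rightarrow> bool" where
  "minkowski_norm F \<longleftrightarrow>
     (\<forall>y. 0 \<le> F y) \<and>
     smooth_on (UNIV - {0}) F \<and>
     (\<forall>c>0. \<forall>y. F (c *\<^sub>R y) = c * F y) \<and>
     (\<forall>y. y \<noteq> 0 \<longrightarrow> (\<forall>u. u \<noteq> 0 \<longrightarrow> 0 < fundamental_form F y u u))"

definition form_norm :: "(real^'n \<Rightarrow> real) \<Rightarrow> (real^'n) \<Rightarrow>\<^sub>L real \<Rightarrow> real" where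
  "form_norm F \<beta> = (SUP y\<in>UNIV - {0}. \<bar>blinfun_apply \<beta> y\<bar> / F y)"

text \<open>Since a tuple of linearly independent 1-forms has length \<open>q \<le> n\<close>, it is written as a family
  \<open>\<beta>\<close> indexed by a set \<open>I\<close> of \<open>q\<close> coordinate indices, so \<open>q = card I\<close>; the values of \<open>\<beta>\<close> and
  \<open>\<delta>\<close> outside \<open>I\<close> play no role. Correspondingly, the space of \<open>q\<close> real variables is the
  coordinate subspace of vectors vanishing outside \<open>I\<close>, and the product of the intervals
  is the following subset of it. As a function on a subset of this subspace is smooth iff it
  extends smoothly to a neighbourhood in the whole space, \<open>smooth_on (form_box I \<delta>) \<phi>\<close> is
  smoothness in the \<open>q\<close> variables.\<close>

definition form_box :: "'n set \<Rightarrow> ('n \<Rightarrow> real) \<Rightarrow> (real^'n) set" where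
  "form_box I \<delta> = {s. (\<forall>i\<in>I. s $ i \<in> {- \<delta> i..\<delta> i}) \<and> (\<forall>i. i \<notin> I \<longrightarrow> s $ i = 0)}"

text \<open>One-sided at the end points of the interval.\<close>

definition partial_deriv ::
    "('n \<Rightarrow> real) \<Rightarrow> (real^'n \<Rightarrow> real) \<Rightarrow> 'n \<Rightarrow> real^'n \<Rightarrow> real" where
  "partial_deriv \<delta> \<phi> i s =
     vector_derivative (\<lambda>t. \<phi> (\<chi> j. if j = i then t else s $ j))
       (at (s $ i) within {- \<delta> i..\<delta> i})"

definition admissible_deformation ::
    "(real^'n \<Rightarrow> real) \<Rightarrow> 'n set \<Rightarrow> ('n \<Rightarrow> (real^'n) \<Rightarrow>\<^sub>L real) \<Rightarrow> ('n \<Rightarrow> real) \<Rightarrow>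
     (real^'n \<Rightarrow> real) \<Rightarrow> bool" where
  "admissible_deformation F I \<beta> \<delta> \<phi> \<longleftrightarrow>
     inj_on \<beta> I \<and> independent (\<beta> ` I) \<and>
     (\<forall>i\<in>I. form_norm F (\<beta> i) < \<delta> i) \<and>
     smooth_on (form_box I \<delta>) \<phi> \<and>
     (\<forall>s\<in>form_box I \<delta>. 0 < \<phi> s) \<and>
     (\<forall>s\<in>form_box I \<delta>. 0 < \<phi> s - (\<Sum>i\<in>I. s $ i * partial_deriv \<delta> \<phi> i s))"

text \<open>At \<open>y = 0\<close> the value is \<open>0\<close> for a Minkowski norm \<open>F\<close>, whatever the quotients are.\<close>

definition deformation ::
    "'n set \<Rightarrow> ('n \<Rightarrow> (real^'n) \<Rightarrow>\<^sub>L real) \<Rightarrow> (real^'n \<Rightarrow> real) \<Rightarrow>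
     (real^'n \<Rightarrow> real) \<Rightarrow> (real^'n \<Rightarrow> real)" where
  "deformation I \<beta> \<phi> F =
     (\<lambda>y. F y * \<phi> (\<chi> i. if i \<in> I then blinfun_apply (\<beta> i) y / F y else 0))"

definition deformation_equiv ::
    "nat \<Rightarrow> (real^'n \<Rightarrow> real) \<Rightarrow> (real^'n \<Rightarrow> real) \<Rightarrow> bool" where
  "deformation_equiv p Fbar F \<longleftrightarrow>
     (\<exists>(m::nat) Fs. 1 \<le> m \<and> Fs 0 = F \<and> Fs m = Fbar \<and> (\<forall>i\<le>m. minkowski_norm (Fs i)) \<and>
        (\<forall>i\<in>{1..m}. \<exists>I \<beta> \<delta> \<phi>. card I \<le> p \<and>
           admissible_deformation (Fs (i - 1)) I \<beta> \<delta> \<phi> \<and>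
           Fs i = deformation I \<beta> \<phi> (Fs (i - 1))))"

end

theory Submission
  imports Defs
begin

text \<open>
  Reflexivity uses the deformation by the empty tuple of forms and the constant \<open>1\<close>, and
  transitivity concatenates chains. Symmetry is the point: one has to undo a single deformation
  \<open>F' = F \<cdot> \<phi>(\<beta>/F)\<close> by a deformation \<open>F = F' \<cdot> \<psi>(\<beta>/F')\<close> along the same forms, so the only
  task is to find \<open>\<psi>\<close>; a chain is then inverted step by step.

  Writing \<open>s = \<beta>/F\<close> and \<open>u = \<beta>/F'\<close> one has \<open>u = s/\<phi>(s)\<close>, and \<open>\<psi>(u)\<close> must be \<open>1/\<phi>(s)\<close>. So
  \<open>w = \<psi>(u)\<close> solves \<open>w \<cdot> \<phi>(u/w) = 1\<close>. The left side has \<open>w\<close>-derivative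
  \<open>\<phi> - \<Sum> s\<^sub>i \<partial>\<phi>/\<partial>s\<^sub>i\<close> at \<open>s = u/w\<close>, which is positive by the standing assumption: this gives
  uniqueness of \<open>w\<close>, and invertibility of the derivative of \<open>s \<mapsto> s/\<phi>(s)\<close>, hence smoothness
  of \<open>\<psi>\<close> where it is defined. It also gives the standing assumption for \<open>\<psi>\<close>, because
  \<open>\<psi> - \<Sum> u\<^sub>i \<partial>\<psi>/\<partial>u\<^sub>i = 1 / (\<phi> - \<Sum> s\<^sub>i \<partial>\<phi>/\<partial>s\<^sub>i)\<close> (lemma \<open>invert_deformation_function\<close>).

  The obstacle is that the image of the box under \<open>s \<mapsto> s/\<phi>(s)\<close> is only star-shaped and need not
  contain a box that contains all values of \<open>\<beta>/F'\<close>. Therefore \<open>\<phi>\<close> is first replaced by a function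
  on the whole space with the same properties that agrees with \<open>\<phi>\<close> at all values of \<open>\<beta>/F\<close>
  (lemma \<open>extend_deformation_function\<close>). Both conditions on \<open>\<phi>\<close> are linear in \<open>\<phi>\<close>, so they survive
  the interpolation \<open>c + \<theta> (\<phi> - c)\<close> between \<open>\<phi>\<close> and a positive constant \<open>c\<close>, up to the term
  \<open>(\<phi> - c) \<Sum> s\<^sub>i \<partial>\<theta>/\<partial>s\<^sub>i\<close>; this term has the right sign if \<open>c\<close> is the minimum of \<open>\<phi>\<close> on the box
  and the cutoff \<open>\<theta>\<close> decreases along rays. The extended function lies between two positive
  constants, so \<open>w \<cdot> \<phi>(u/w) = 1\<close> has a solution for every \<open>u\<close>, and \<open>\<psi>\<close> is defined everywhere.
\<close>

section \<open>Calculus of \<open>C\<^sup>k\<close> functions\<close>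

lemma Ck_on_subset: "Ck_on k U f \<Longrightarrow> V \<subseteq> U \<Longrightarrow> Ck_on k V f"
  by (induction k arbitrary: f) (auto intro: continuous_on_subset)

lemma Ck_on_cong:
  assumes "open U" "\<And>x. x \<in> U \<Longrightarrow> f x = g x" "Ck_on k U f"
  shows "Ck_on k U g"
  using assms(2,3)
proof (induction k arbitrary: f g)
  case 0
  then show ?case by (auto cong: continuous_on_cong)
next
  case (Suc k)
  have der: "(g has_derivative frechet_derivative f (at x)) (at x)" if "x \<in> U" for x
    using Suc.prems that assms(1)
    by (intro has_derivative_transform_within_open[of f _ x UNIV U g])
       (auto simp: frechet_derivative_works)
  have "Ck_on k U (\<lambda>x. frechet_derivative g (at x) v)" for v
    by (rule Suc.IH[of "\<lambda>x. frechet_derivative f (at x) v"])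
       (use Suc.prems der in \<open>auto simp: frechet_derivative_at[OF der, symmetric]\<close>)
  then show ?case using der by (auto simp: differentiable_def)
qed

text \<open>The recursion step of \<open>Ck_on\<close> in terms of any known derivative, instead of the one
  selected by \<open>frechet_derivative\<close>.\<close>

lemma Ck_on_SucI:
  assumes "open U" "\<And>x. x \<in> U \<Longrightarrow> (f has_derivative D x) (at x)"
    and "\<And>v. Ck_on k U (\<lambda>x. D x v)"
  shows "Ck_on (Suc k) U f"
proof -
  have "Ck_on k U (\<lambda>x. frechet_derivative f (at x) v)" for v
    by (rule Ck_on_cong[OF assms(1) _ assms(3)[of v]])
       (simp add: frechet_derivative_at[OF assms(2), symmetric])
  then show ?thesis using assms(2) by (auto simp: differentiable_def)
qed

lemma Ck_on_SucD:
  assumes "Ck_on (Suc k) U f"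
  shows "x \<in> U \<Longrightarrow> (f has_derivative frechet_derivative f (at x)) (at x)"
    and "Ck_on k U (\<lambda>x. frechet_derivative f (at x) v)"
  using assms by (auto simp: frechet_derivative_works)

lemma Ck_on_lower: "Ck_on (Suc k) U f \<Longrightarrow> Ck_on k U f"
proof (induction k arbitrary: f)
  case 0
  then show ?case
    by (auto intro!: continuous_at_imp_continuous_on differentiable_imp_continuous_within)
qed (metis Ck_on.simps(2))

lemma Ck_on_Un:
  assumes "open U" "open V" "Ck_on k U f" "Ck_on k V f"
  shows "Ck_on k (U \<union> V) f"
  using assms(3,4) by (induction k arbitrary: f) (auto intro: continuous_on_open_Un assms)

lemma Ck_on_const: "Ck_on k U (\<lambda>x. c)"
  by (induction k arbitrary: c) (auto simp: frechet_derivative_const)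

lemma Ck_on_linear:
  assumes "open U" "bounded_linear f"
  shows "Ck_on k U f"
proof (cases k)
  case 0
  then show ?thesis using assms by (simp add: linear_continuous_on)
next
  case (Suc j)
  then show ?thesis
    using Ck_on_SucI[of U f "\<lambda>x. f" j] assms
    by (simp add: bounded_linear_imp_has_derivative Ck_on_const)
qed

lemma Ck_on_add:
  assumes "open U" "Ck_on k U f" "Ck_on k U g"
  shows "Ck_on k U (\<lambda>x. f x + g x)"
  using assms(2,3)
proof (induction k arbitrary: f g)
  case (Suc k)
  show ?case
    by (rule Ck_on_SucI[OF assms(1) has_derivative_add[OF Ck_on_SucD(1) Ck_on_SucD(1)]])
       (use Suc in auto)
qed (simp add: continuous_on_add)

lemma Ck_on_mult:
  assumes "open U" "Ck_on k U f" "Ck_on k U g"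
  shows "Ck_on k U (\<lambda>x. f x * g x)"
  using assms(2,3)
proof (induction k arbitrary: f g)
  case (Suc k)
  note low = Ck_on_lower[OF Suc.prems(1)] Ck_on_lower[OF Suc.prems(2)]
  let ?D = "\<lambda>x v. f x * frechet_derivative g (at x) v + frechet_derivative f (at x) v * g x"
  have "Ck_on k U (\<lambda>x. ?D x v)" for v
    by (intro Ck_on_add assms(1) Suc.IH low Ck_on_SucD(2) Suc.prems)
  moreover have "((\<lambda>x. f x * g x) has_derivative ?D x) (at x)" if "x \<in> U" for x
    by (intro has_derivative_mult Ck_on_SucD(1)[OF Suc.prems(1) that]
        Ck_on_SucD(1)[OF Suc.prems(2) that])
  ultimately show ?case
    by (intro Ck_on_SucI[OF assms(1), where D = ?D])
qed (simp add: continuous_on_mult)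

lemma Ck_on_sum:
  assumes "open U" "\<And>i. i \<in> A \<Longrightarrow> Ck_on k U (f i)"
  shows "Ck_on k U (\<lambda>x. \<Sum>i\<in>A. f i x)"
  using assms(2) by (induction A rule: infinite_finite_induct)
    (auto intro!: Ck_on_add Ck_on_const assms(1))

lemma Ck_on_compose:
  fixes h :: "'a::euclidean_space \<Rightarrow> 'b::euclidean_space"
  assumes U: "open U" and V: "open V" "h ` U \<subseteq> V"
    and "Ck_on k V f" "\<And>b. b \<in> Basis \<Longrightarrow> Ck_on k U (\<lambda>x. h x \<bullet> b)"
  shows "Ck_on k U (\<lambda>x. f (h x))"
  using assms(4,5)
proof (induction k arbitrary: f)
  case 0
  then have "continuous_on U h"
    by (auto intro: continuous_on_componentwise[THEN iffD2])
  then show ?case using 0 V by (auto intro: continuous_on_compose2)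
next
  case (Suc k)
  define D where "D x v = (\<Sum>b\<in>Basis. frechet_derivative (\<lambda>x. h x \<bullet> b) (at x) v *\<^sub>R b)" for x v
  have comp: "D x v \<bullet> b = frechet_derivative (\<lambda>x. h x \<bullet> b) (at x) v" if "b \<in> Basis" for x v b
    using that by (simp add: D_def inner_sum_left inner_Basis if_distrib cong: if_cong)
  have h: "(h has_derivative D x) (at x)" if "x \<in> U" for x
    using Ck_on_SucD(1)[OF Suc.prems(2)] that
    by (subst has_derivative_componentwise_within) (auto simp: comp)
  have f: "(f has_derivative frechet_derivative f (at (h x))) (at (h x))" if "x \<in> U" for x
    using Ck_on_SucD(1)[OF Suc.prems(1)] that V by blast
  have eq: "frechet_derivative f (at (h x)) (D x v) = (\<Sum>b\<in>Basis.
      frechet_derivative (\<lambda>x. h x \<bullet> b) (at x) v * frechet_derivative f (at (h x)) b)"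
    if "x \<in> U" for x v
  proof -
    have "linear (frechet_derivative f (at (h x)))" using f[OF that] has_derivative_linear by blast
    then show ?thesis by (simp add: D_def linear_sum linear_cmul)
  qed
  have "Ck_on k U (\<lambda>x. \<Sum>b\<in>Basis.
      frechet_derivative (\<lambda>x. h x \<bullet> b) (at x) v * frechet_derivative f (at (h x)) b)" for v
  proof (intro Ck_on_sum Ck_on_mult U)
    fix b :: 'b
    assume "b \<in> Basis"
    then show "Ck_on k U (\<lambda>x. frechet_derivative (\<lambda>x. h x \<bullet> b) (at x) v)"
      using Suc.prems(2) Ck_on_SucD(2) by blast
    show "Ck_on k U (\<lambda>x. frechet_derivative f (at (h x)) b)"
      by (rule Suc.IH[OF Ck_on_SucD(2)[OF Suc.prems(1)] Ck_on_lower[OF Suc.prems(2)]])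
  qed
  then have "Ck_on k U (\<lambda>x. frechet_derivative f (at (h x)) (D x v))" for v
    using Ck_on_cong[OF U, of "\<lambda>x. \<Sum>b\<in>Basis. frechet_derivative (\<lambda>x. h x \<bullet> b) (at x) v *
      frechet_derivative f (at (h x)) b" "\<lambda>x. frechet_derivative f (at (h x)) (D x v)" k]
    by (simp add: eq)
  then show ?case
    by (intro Ck_on_SucI[OF U, where D = "\<lambda>x v. frechet_derivative f (at (h x)) (D x v)"])
       (auto intro: has_derivative_compose[OF h f])
qed

lemma Ck_on_compose_real:
  fixes h :: "'a::euclidean_space \<Rightarrow> real"
  assumes "open U" "open V" "h ` U \<subseteq> V" "Ck_on k V f" "Ck_on k U h"
  shows "Ck_on k U (\<lambda>x. f (h x))"
  by (rule Ck_on_compose[OF assms(1-4)]) (use assms(5) in auto)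

lemma Ck_on_inverse_real: "Ck_on k (- {0}) (inverse :: real \<Rightarrow> real)"
proof (induction k)
  case (Suc k)
  have "Ck_on k (- {0}) (\<lambda>x. (- v) * (inverse x * inverse x))" for v :: real
    by (intro Ck_on_mult Ck_on_const Suc) auto
  moreover have "(inverse has_derivative (\<lambda>v. (- v) * (inverse x * inverse x))) (at x)"
    if "x \<in> - {0}" for x :: real
    using that by (auto intro!: derivative_eq_intros)
  ultimately show ?case
    by (intro Ck_on_SucI[where D = "\<lambda>x v. (- v) * (inverse x * inverse x)"]) auto
qed (simp add: continuous_on_inverse)

lemma Ck_on_divide:
  assumes "open U" "Ck_on k U f" "Ck_on k U g" "\<And>x. x \<in> U \<Longrightarrow> g x \<noteq> 0"
  shows "Ck_on k U (\<lambda>x. f x / g x)"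
  unfolding divide_inverse
  by (intro Ck_on_mult assms Ck_on_compose_real[OF _ _ _ Ck_on_inverse_real])
     (use assms in auto)


lemma Ck_on_vec_nth: "Ck_on k UNIV (\<lambda>s::real^'n. s $ i)"
  by (intro Ck_on_linear bounded_linear_vec_nth) auto

lemma Ck_on_radial_derivative:
  assumes "\<And>k. Ck_on k UNIV g"
  shows "Ck_on k UNIV (\<lambda>x. frechet_derivative g (at x) x)"
proof -
  have "frechet_derivative g (at x) x = (\<Sum>b\<in>Basis. (x \<bullet> b) * frechet_derivative g (at x) b)" for x
  proof -
    have "linear (frechet_derivative g (at x))"
      using Ck_on_SucD(1)[OF assms] has_derivative_linear by blast
    then have "(\<Sum>b\<in>Basis. (x \<bullet> b) * frechet_derivative g (at x) b) =
        frechet_derivative g (at x) (\<Sum>b\<in>Basis. (x \<bullet> b) *\<^sub>R b)"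
      by (simp add: linear_sum linear_cmul)
    then show ?thesis by (simp add: euclidean_representation)
  qed
  moreover have "Ck_on k UNIV (\<lambda>x. \<Sum>b\<in>Basis. (x \<bullet> b) * frechet_derivative g (at x) b)"
    by (intro Ck_on_sum Ck_on_mult Ck_on_SucD(2)[OF assms] Ck_on_linear bounded_linear_inner_left) auto
  ultimately show ?thesis by simp
qed

section \<open>Smooth cutoff functions that decrease along rays\<close>

definition flat :: "nat \<Rightarrow> real \<Rightarrow> real" where
  "flat k x = (if 0 < x then inverse x ^ k * exp (- inverse x) else 0)"

lemma flat_tendsto_0: "(flat k \<longlongrightarrow> 0) (at 0)"
proof (rule filterlim_split_at)
  have "eventually (\<lambda>x. flat k x = 0) (at_left 0)"
    by (auto simp: eventually_at_filter flat_def)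
  then show "(flat k \<longlongrightarrow> 0) (at_left 0)"
    by (simp add: tendsto_eventually)
  have "((\<lambda>x. inverse x ^ k / exp (inverse x)) \<longlongrightarrow> (0::real)) (at_right 0)"
    by (rule filterlim_compose[OF tendsto_power_div_exp_0 filterlim_inverse_at_top_right])
  moreover have "eventually (\<lambda>x. inverse x ^ k / exp (inverse x) = flat k x) (at_right 0)"
    by (auto simp: eventually_at_filter flat_def exp_minus divide_inverse)
  ultimately show "(flat k \<longlongrightarrow> 0) (at_right 0)"
    by (rule Lim_transform_eventually)
qed

text \<open>The derivatives of \<open>exp (- 1 / x)\<close> stay in the span of the functions \<open>flat k\<close>, which is
  why the whole family is studied at once. At \<open>0\<close> the difference quotient of \<open>flat k\<close> is
  \<open>flat (k + 1)\<close>.\<close>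

lemma has_real_derivative_flat:
  "(flat k has_real_derivative flat (k + 2) x - k * flat (k + 1) x) (at x)"
proof (cases "x = 0")
  case True
  have "(\<lambda>y. (flat k y - flat k 0) / (y - 0)) = flat (k + 1)"
    by (auto simp: flat_def fun_eq_iff divide_inverse)
  then have "(flat k has_real_derivative 0) (at 0)"
    using flat_tendsto_0[of "k + 1"] by (simp add: has_field_derivative_iff)
  then show ?thesis using True by (simp add: flat_def)
next
  case False
  then consider "x < 0" | "0 < x" by linarith
  then show ?thesis
  proof cases
    case 1
    have "(flat k has_real_derivative 0) (at x)"
      by (rule has_field_derivative_transform_within_open[of "\<lambda>_. 0" _ _ "{..<0}"])
         (use 1 in \<open>auto simp: flat_def\<close>)
    then show ?thesis using 1 by (simp add: flat_def)
  next
    case 2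
    have "((\<lambda>x. inverse x ^ k * exp (- inverse x)) has_real_derivative
        flat (k + 2) x - k * flat (k + 1) x) (at x)"
      using 2 by (auto intro!: derivative_eq_intros simp: flat_def algebra_simps power2_eq_square)
        (cases k; simp)
    then show ?thesis
      by (rule has_field_derivative_transform_within_open[where S = "{0<..}"])
         (use 2 in \<open>auto simp: flat_def\<close>)
  qed
qed

lemma Ck_on_flat: "Ck_on j UNIV (flat k)"
proof (induction j arbitrary: k)
  case 0
  show ?case
    using DERIV_isCont[OF has_real_derivative_flat] by (simp add: continuous_at_imp_continuous_on)
next
  case (Suc j)
  have "Ck_on j UNIV (\<lambda>x. flat (k + 2) x * v + flat (k + 1) x * (- k * v))" for v :: real
    by (intro Ck_on_add Ck_on_mult Suc.IH Ck_on_const open_UNIV)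
  moreover have "(flat k has_derivative (\<lambda>v. flat (k + 2) x * v + flat (k + 1) x * (- k * v))) (at x)" for x
    using has_real_derivative_flat[of k x]
    by (rule has_derivative_eq_rhs[OF has_field_derivative_imp_has_derivative])
       (simp add: fun_eq_iff algebra_simps)
  ultimately show ?case
    by (intro Ck_on_SucI[where D = "\<lambda>x v. flat (k + 2) x * v + flat (k + 1) x * (- k * v)"]) auto
qed

text \<open>A smooth monotone transition from the value \<open>0\<close> on \<open>x \<le> 0\<close> to \<open>1\<close> on \<open>x \<ge> 1\<close>.\<close>

definition smooth_step :: "real \<Rightarrow> real" where
  "smooth_step x = flat 0 x / (flat 0 x + flat 0 (1 - x))"

lemma flat_nonneg: "0 \<le> flat k x"
  by (simp add: flat_def)

lemma smooth_step_denominator_pos: "0 < flat 0 x + flat 0 (1 - x)"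
  by (cases "0 < x"; cases "0 < 1 - x") (auto simp: flat_def intro: add_pos_pos)

lemma Ck_on_smooth_step: "Ck_on k UNIV smooth_step"
proof -
  have "Ck_on k UNIV (\<lambda>x::real. 1 - x)"
    using Ck_on_add[OF _ Ck_on_const Ck_on_linear[OF _ bounded_linear_minus[OF bounded_linear_ident]],
        of UNIV k 1] by simp
  then have "Ck_on k UNIV (\<lambda>x. flat 0 (1 - x))"
    by (intro Ck_on_compose_real[OF _ _ _ Ck_on_flat]) auto
  then show ?thesis
    unfolding smooth_step_def[abs_def]
    using smooth_step_denominator_pos
    by (intro Ck_on_divide Ck_on_add Ck_on_flat) (auto simp: less_le)
qed

lemma smooth_step_bounds: "0 \<le> smooth_step x" "smooth_step x \<le> 1"
  using smooth_step_denominator_pos[of x] flat_nonneg[of 0 x] flat_nonneg[of 0 "1 - x"]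
  by (auto simp: smooth_step_def)

lemma smooth_step_eq_0: "x \<le> 0 \<Longrightarrow> smooth_step x = 0"
  by (simp add: smooth_step_def flat_def)

lemma smooth_step_eq_1: "1 \<le> x \<Longrightarrow> smooth_step x = 1"
  using smooth_step_denominator_pos[of x] by (simp add: smooth_step_def flat_def)

lemma smooth_step_derivative_nonneg:
  obtains D where "0 \<le> D" "(smooth_step has_real_derivative D) (at x)"
proof
  let ?D = "(flat 2 x * flat 0 (1 - x) + flat 0 x * flat 2 (1 - x)) / (flat 0 x + flat 0 (1 - x))\<^sup>2"
  show "0 \<le> ?D" by (simp add: flat_nonneg)
  have "(flat 0 has_real_derivative flat 2 y) (at y)" for y
    using has_real_derivative_flat[of 0 y] by (simp add: numeral_2_eq_2)
  note [derivative_intros] = DERIV_chain2[OF this]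
  show "(smooth_step has_real_derivative ?D) (at x)"
    unfolding smooth_step_def[abs_def] using smooth_step_denominator_pos[of x]
    by (auto intro!: derivative_eq_intros simp: power2_eq_square algebra_simps divide_simps)
qed

text \<open>The last condition says that the function does not increase along rays from the origin. In
  this differential form the property passes to products by the Leibniz rule, so that a cutoff
  adapted to a box can be assembled from the coordinates.\<close>

definition radial_cutoff :: "('a::euclidean_space \<Rightarrow> real) \<Rightarrow> bool" where
  "radial_cutoff \<theta> \<longleftrightarrow> (\<forall>k. Ck_on k UNIV \<theta>) \<and> (\<forall>s. 0 \<le> \<theta> s \<and> \<theta> s \<le> 1) \<and>
     (\<forall>s. frechet_derivative \<theta> (at s) s \<le> 0)"

lemma radial_cutoff_mult:
  assumes "radial_cutoff \<theta>" "radial_cutoff \<eta>"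
  shows "radial_cutoff (\<lambda>s. \<theta> s * \<eta> s)"
proof -
  have der: "(\<theta> has_derivative frechet_derivative \<theta> (at s)) (at s)"
    "(\<eta> has_derivative frechet_derivative \<eta> (at s)) (at s)" for s
    using assms Ck_on_SucD(1) unfolding radial_cutoff_def by blast+
  have "frechet_derivative (\<lambda>s. \<theta> s * \<eta> s) (at s) s \<le> 0" for s
    using assms unfolding radial_cutoff_def
    by (subst frechet_derivative_at[OF has_derivative_mult[OF der], symmetric])
       (intro add_nonpos_nonpos mult_nonneg_nonpos mult_nonpos_nonneg; blast)
  then show ?thesis
    using assms unfolding radial_cutoff_def by (auto intro: Ck_on_mult mult_le_one)
qed

lemma radial_cutoff_prod:
  fixes \<theta> :: "'i \<Rightarrow> 'a::euclidean_space \<Rightarrow> real"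
  assumes "\<And>i. i \<in> A \<Longrightarrow> radial_cutoff (\<theta> i)"
  shows "radial_cutoff (\<lambda>s. \<Prod>i\<in>A. \<theta> i s)"
proof -
  have "radial_cutoff (\<lambda>s::'a. 1)"
    by (simp add: radial_cutoff_def Ck_on_const frechet_derivative_const)
  then show ?thesis
    using assms by (induction A rule: infinite_finite_induct) (auto intro: radial_cutoff_mult)
qed

text \<open>This cutoff is \<open>1\<close> for \<open>\<bar>s $ i\<bar> \<le> a\<close> and \<open>0\<close> for \<open>\<bar>s $ i\<bar> \<ge> b\<close>. Using squares avoids the corner
  of the absolute value.\<close>

lemma radial_cutoff_coordinate:
  fixes i :: "'n::finite" and a b :: real
  assumes "0 \<le> a" "a < b"
  shows "radial_cutoff (\<lambda>s::real^'n. smooth_step ((b\<^sup>2 - (s $ i)\<^sup>2) / (b\<^sup>2 - a\<^sup>2)))"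
proof -
  define c where "c = b\<^sup>2 - a\<^sup>2"
  have c: "0 < c" using assms by (simp add: c_def power_strict_mono)
  have q: "(b\<^sup>2 - (s $ i)\<^sup>2) / c = b\<^sup>2 / c + (- 1 / c) * (s $ i * s $ i)" for s :: "real^'n"
    using c by (simp add: field_simps power2_eq_square)
  have "Ck_on k UNIV (\<lambda>s::real^'n. b\<^sup>2 / c + (- 1 / c) * (s $ i * s $ i))" for k
    by (intro Ck_on_add Ck_on_mult Ck_on_const Ck_on_vec_nth open_UNIV)
  then have "Ck_on k UNIV (\<lambda>s::real^'n. smooth_step ((b\<^sup>2 - (s $ i)\<^sup>2) / c))" for k
    unfolding q by (intro Ck_on_compose_real[OF _ _ _ Ck_on_smooth_step]) auto
  moreover have "frechet_derivative (\<lambda>s::real^'n. smooth_step ((b\<^sup>2 - (s $ i)\<^sup>2) / c)) (at s) s \<le> 0" for s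
  proof -
    obtain D where D: "0 \<le> D"
      "(smooth_step has_real_derivative D) (at ((b\<^sup>2 - (s $ i)\<^sup>2) / c))"
      by (rule smooth_step_derivative_nonneg)
    have "((\<lambda>s::real^'n. (b\<^sup>2 - (s $ i)\<^sup>2) / c) has_derivative (\<lambda>v. - (2 * s $ i * v $ i) / c)) (at s)"
      using c by (auto intro!: derivative_eq_intros bounded_linear_imp_has_derivative
          bounded_linear_vec_nth simp: field_simps)
    from has_derivative_compose[OF this D(2)[unfolded has_field_derivative_def]]
    have "frechet_derivative (\<lambda>s::real^'n. smooth_step ((b\<^sup>2 - (s $ i)\<^sup>2) / c)) (at s) =
        (\<lambda>v. D * (- (2 * s $ i * v $ i) / c))"
      by (rule frechet_derivative_at[symmetric])
    then show ?thesis using D(1) c by (simp add: mult_nonneg_nonneg)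
  qed
  ultimately show ?thesis
    using smooth_step_bounds by (simp add: radial_cutoff_def c_def)
qed

section \<open>Extending a deformation function beyond its box\<close>

lemma compact_form_box: "compact (form_box I \<delta>)"
proof -
  have "form_box I \<delta> = cbox (\<chi> i. if i \<in> I then - \<delta> i else 0) (\<chi> i. if i \<in> I then \<delta> i else 0)"
    by (auto simp: form_box_def set_eq_iff mem_box_cart split: if_splits) (metis order_antisym)+
  then show ?thesis by simp
qed

text \<open>The extension is \<open>c + \<theta> (h - c)\<close>, where \<open>c\<close> is the minimum of \<open>h\<close> on the box and \<open>\<theta>\<close> is a radial
  cutoff that is \<open>1\<close> on the smaller box \<open>form_box I a\<close>. Its radial expression
  \<open>g - \<Sum> s\<^sub>i \<partial>g/\<partial>s\<^sub>i\<close> is the convex combination of \<open>c\<close> and \<open>h - \<Sum> s\<^sub>i \<partial>h/\<partial>s\<^sub>i\<close> with weights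
  \<open>1 - \<theta>\<close> and \<open>\<theta>\<close>, plus \<open>- (h - c) \<Sum> s\<^sub>i \<partial>\<theta>/\<partial>s\<^sub>i\<close>; the first part is positive and the second
  nonnegative.\<close>

lemma extend_deformation_function:
  fixes h :: "real^'n::finite \<Rightarrow> real"
  assumes ab: "\<And>i. i \<in> I \<Longrightarrow> 0 \<le> a i \<and> a i < \<delta> i"
    and U: "open U" "form_box I \<delta> \<subseteq> U"
    and h: "\<And>k. Ck_on k U h"
    and pos: "\<And>s. s \<in> form_box I \<delta> \<Longrightarrow> 0 < h s"
    and rad: "\<And>s. s \<in> form_box I \<delta> \<Longrightarrow> 0 < h s - frechet_derivative h (at s) s"
  obtains g c M where "\<And>k. Ck_on k UNIV g" "0 < c" "\<And>s. c \<le> g s" "\<And>s. g s \<le> M"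
    "\<And>s. 0 < g s - frechet_derivative g (at s) s"
    "\<And>s. s \<in> form_box I a \<Longrightarrow> g s = h s"
proof -
  define b where "b i = (a i + \<delta> i) / 2" for i
  have b: "0 \<le> a i" "a i < b i" "b i < \<delta> i" if "i \<in> I" for i
    using ab[OF that] by (auto simp: b_def)
  \<comment> \<open>The hypotheses concern \<open>h\<close> only on the coordinate subspace of \<open>I\<close>; composing with the
    projection onto it makes them available off the subspace.\<close>
  define P :: "real^'n \<Rightarrow> real^'n" where "P s = (\<chi> i. if i \<in> I then s $ i else 0)" for s
  have P: "bounded_linear P"
    by (rule linear_conv_bounded_linear[THEN iffD1], rule linearI) (auto simp: P_def vec_eq_iff)
  define V where "V = P -` U"
  have V: "open V"
    unfolding V_def using U(1) P by (intro open_vimage linear_continuous_on)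
  define H where "H s = h (P s)" for s
  have H: "Ck_on k V H" for k
    unfolding H_def
    by (rule Ck_on_compose[OF V U(1) _ h])
       (auto simp: V_def inner_Basis intro!: Ck_on_linear V[unfolded V_def]
          bounded_linear_compose[OF bounded_linear_inner_left P])
  define \<theta> where "\<theta> s = (\<Prod>i\<in>I. smooth_step (((b i)\<^sup>2 - (s $ i)\<^sup>2) / ((b i)\<^sup>2 - (a i)\<^sup>2)))" for s :: "real^'n"
  have \<theta>: "radial_cutoff \<theta>"
    unfolding \<theta>_def by (intro radial_cutoff_prod radial_cutoff_coordinate b)
  then have \<theta>_bounds: "0 \<le> \<theta> s" "\<theta> s \<le> 1" and \<theta>_Ck: "Ck_on k UNIV \<theta>"
    and \<theta>_rad: "frechet_derivative \<theta> (at s) s \<le> 0" for s k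
    by (auto simp: radial_cutoff_def)
  have gap: "0 < (b i)\<^sup>2 - (a i)\<^sup>2" if "i \<in> I" for i
    using b[OF that] by (simp add: power_strict_mono)
  \<comment> \<open>Gluing: \<open>V\<close> is where the projected function is defined, \<open>W\<close> is an open set on which the
    cutoff vanishes, and together they cover the space.\<close>
  define W where "W = (\<Union>i\<in>I. {s::real^'n. b i < \<bar>s $ i\<bar>})"
  have W: "open W"
    unfolding W_def by (intro open_UN ballI open_Collect_less continuous_intros)
  have \<theta>_0: "\<theta> s = 0" if "s \<in> W" for s
  proof -
    obtain i where i: "i \<in> I" "b i < \<bar>s $ i\<bar>" using \<open>s \<in> W\<close> by (auto simp: W_def)
    then have "(b i)\<^sup>2 \<le> (s $ i)\<^sup>2"
      using b[OF i(1)] power_mono[of "b i" "\<bar>s $ i\<bar>" 2] by simp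
    then have "((b i)\<^sup>2 - (s $ i)\<^sup>2) / ((b i)\<^sup>2 - (a i)\<^sup>2) \<le> 0"
      using gap[OF i(1)] by (simp add: divide_nonpos_pos)
    then show ?thesis
      unfolding \<theta>_def using i(1) by (intro prod_zero bexI[of _ i] smooth_step_eq_0) auto
  qed
  have box: "P s \<in> form_box I \<delta>" "s \<in> V" if "s \<notin> W" for s
  proof -
    have "- \<delta> i \<le> s $ i \<and> s $ i \<le> \<delta> i" if "i \<in> I" for i
      using \<open>s \<notin> W\<close> that b(3)[OF that] by (force simp: W_def abs_le_iff not_less)
    then show "P s \<in> form_box I \<delta>"
      by (auto simp: form_box_def P_def)
    then show "s \<in> V" using U(2) by (auto simp: V_def)
  qed
  have "0 \<in> form_box I \<delta>"
    using ab by (force simp: form_box_def)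
  then have ne: "form_box I \<delta> \<noteq> {}" by blast
  have cont: "continuous_on (form_box I \<delta>) h"
    using h[of 0] U(2) by (auto intro: continuous_on_subset)
  obtain s0 where s0: "s0 \<in> form_box I \<delta>" "\<And>s. s \<in> form_box I \<delta> \<Longrightarrow> h s0 \<le> h s"
    using continuous_attains_inf[OF compact_form_box ne cont] by blast
  obtain s1 where s1: "s1 \<in> form_box I \<delta>" "\<And>s. s \<in> form_box I \<delta> \<Longrightarrow> h s \<le> h s1"
    using continuous_attains_sup[OF compact_form_box ne cont] by blast
  define c where "c = h s0"
  have c: "0 < c" using pos s0 by (simp add: c_def)
  define g where "g s = (if s \<in> V then c + \<theta> s * (H s - c) else c)" for s
  have g_W: "g s = c" if "s \<in> W" for s
    using \<theta>_0[OF that] by (simp add: g_def)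
  have g_V: "g s = c + \<theta> s * (H s - c)" if "s \<in> V" for s
    using that by (simp add: g_def)
  have UV: "V \<union> W = UNIV" using box by blast
  have Ck_V: "Ck_on k V g" for k
  proof (rule Ck_on_cong[OF V])
    show "Ck_on k V (\<lambda>s. c + \<theta> s * (H s + - c))"
      by (intro Ck_on_add Ck_on_mult Ck_on_const V H Ck_on_subset[OF \<theta>_Ck]) auto
  qed (simp add: g_V)
  have "Ck_on k W g" for k
    by (rule Ck_on_cong[OF W _ Ck_on_const[of k W c]]) (simp add: g_W)
  then have Ck: "Ck_on k UNIV g" for k
    using Ck_on_Un[OF V W Ck_V] by (simp add: UV)
  have bounds: "c \<le> g s \<and> g s \<le> h s1" for s
  proof (cases "s \<in> W")
    case True
    then show ?thesis using g_W s0 s1 by (simp add: c_def)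
  next
    case False
    have "c \<le> H s" "H s \<le> h s1" using s0(2) s1(2) box(1)[OF False] by (auto simp: H_def c_def)
    moreover from this have "\<theta> s * (H s - c) \<le> 1 * (H s - c)"
      using \<theta>_bounds by (intro mult_right_mono) auto
    ultimately show ?thesis
      using g_V[OF box(2)[OF False]] \<theta>_bounds[of s] by simp
  qed
  have radial: "0 < g s - frechet_derivative g (at s) s" for s
  proof (cases "s \<in> W")
    case True
    have "(g has_derivative (\<lambda>_. 0)) (at s)"
      by (rule has_derivative_transform_within_open[OF has_derivative_const W True])
         (simp add: g_W)
    from frechet_derivative_at[OF this, symmetric] show ?thesis
      using c by (simp add: g_W[OF True])
  next
    case False
    note sV = box(2)[OF False] and sP = box(1)[OF False]
    let ?\<theta>' = "frechet_derivative \<theta> (at s)" and ?h' = "frechet_derivative h (at (P s))"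
    have d\<theta>: "(\<theta> has_derivative ?\<theta>') (at s)"
      using Ck_on_SucD(1)[OF \<theta>_Ck] by blast
    have "(h has_derivative ?h') (at (P s))"
      using Ck_on_SucD(1)[OF h] sP U(2) by blast
    then have dH: "(H has_derivative (\<lambda>v. ?h' (P v))) (at s)"
      unfolding H_def
      by (rule has_derivative_compose[OF bounded_linear_imp_has_derivative[OF P]])
    have "((\<lambda>s. c + \<theta> s * (H s - c)) has_derivative
        (\<lambda>v. \<theta> s * ?h' (P v) + ?\<theta>' v * (H s - c))) (at s)"
      using d\<theta> dH by (auto intro!: derivative_eq_intros)
    then have "(g has_derivative (\<lambda>v. \<theta> s * ?h' (P v) + ?\<theta>' v * (H s - c))) (at s)"
      by (rule has_derivative_transform_within_open[OF _ V sV]) (simp add: g_V)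
    from frechet_derivative_at[OF this, symmetric]
    have "g s - frechet_derivative g (at s) s =
        ((1 - \<theta> s) * c + \<theta> s * (h (P s) - ?h' (P s))) + (- ?\<theta>' s) * (H s - c)"
      using g_V[OF sV] by (simp add: H_def algebra_simps)
    moreover have "0 \<le> (- ?\<theta>' s) * (H s - c)"
      using \<theta>_rad[of s] s0(2)[OF sP] by (intro mult_nonneg_nonneg) (auto simp: H_def c_def)
    moreover have "0 < (1 - \<theta> s) * c + \<theta> s * (h (P s) - ?h' (P s))"
    proof (cases "\<theta> s = 0")
      case False
      then show ?thesis
        using \<theta>_bounds[of s] c rad[OF sP]
        by (intro add_nonneg_pos mult_nonneg_nonneg mult_pos_pos) auto
    qed (use c in simp)
    ultimately show ?thesis by linarith
  qed
  have "g s = h s" if s: "s \<in> form_box I a" for s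
  proof -
    have "P s = s" using s by (auto simp: form_box_def P_def vec_eq_iff)
    moreover have "s \<notin> W"
      using s b by (force simp: form_box_def W_def)
    moreover have "smooth_step (((b i)\<^sup>2 - (s $ i)\<^sup>2) / ((b i)\<^sup>2 - (a i)\<^sup>2)) = 1" if "i \<in> I" for i
    proof -
      have "\<bar>s $ i\<bar> \<le> a i" using s that by (force simp: form_box_def)
      then have "(s $ i)\<^sup>2 \<le> (a i)\<^sup>2" by (metis abs_ge_zero power2_abs power_mono)
      then show ?thesis using gap[OF that] by (intro smooth_step_eq_1) simp
    qed
    ultimately show ?thesis
      using g_V[OF box(2)] by (simp add: \<theta>_def H_def)
  qed
  then show ?thesis using that Ck c bounds radial by blast
qed

section \<open>Inverting the radial map of a deformation function\<close>

text \<open>The value \<open>\<psi> u\<close> is the solution \<open>w > 0\<close> of \<open>w * g (u / w) = 1\<close>. It exists because the left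
  side lies between \<open>c w\<close> and \<open>M w\<close>, and is unique because its derivative
  \<open>N s = g s - frechet_derivative g (at s) s\<close>, with \<open>s = u / w\<close>, is positive. Differentiability of
  \<open>\<psi>\<close> comes from the inverse function theorem for \<open>\<Phi> s = s / g s\<close>. Differentiating the equation gives
  \<open>- D\<^sub>v g (s) / N s\<close> for the derivative of \<open>\<psi>\<close> in direction \<open>v\<close>, an expression that involves
  \<open>\<psi>\<close> itself but none of its derivatives; this yields \<open>C\<^sup>k\<close> by induction on \<open>k\<close>.\<close>

lemma invert_deformation_function:
  fixes g :: "'a::euclidean_space \<Rightarrow> real"
  assumes Ck: "\<And>k. Ck_on k UNIV g"
    and c: "0 < c" "\<And>s. c \<le> g s" and M: "\<And>s. g s \<le> M"
    and rad: "\<And>s. 0 < g s - frechet_derivative g (at s) s"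
  obtains \<psi> where "\<And>k. Ck_on k UNIV \<psi>" "\<And>u. 0 < \<psi> u"
    "\<And>u. 0 < \<psi> u - frechet_derivative \<psi> (at u) u"
    "\<And>s. \<psi> (s /\<^sub>R g s) = 1 / g s"
proof -
  define G where "G s = frechet_derivative g (at s)" for s
  have G: "(g has_derivative G s) (at s)" for s
    using Ck_on_SucD(1)[OF Ck] by (simp add: G_def)
  have lin_G: "linear (G s)" for s
    using G has_derivative_linear by blast
  have g: "0 < g s" for s using c less_le_trans by blast
  have M': "c \<le> M" using c M order_trans by blast
  define f where "f u w = w * g (u /\<^sub>R w)" for u w
  have f': "(f u has_real_derivative g (u /\<^sub>R w) - G (u /\<^sub>R w) (u /\<^sub>R w)) (at w)"
    if "0 < w" for u w
  proof -
    have "((\<lambda>w. u /\<^sub>R w) has_derivative (\<lambda>t. (- (inverse w * t * inverse w)) *\<^sub>R u)) (at w)"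
      using that by (auto intro!: derivative_eq_intros)
    from has_derivative_compose[OF this G]
    have "((\<lambda>w. g (u /\<^sub>R w)) has_derivative
        (\<lambda>t. G (u /\<^sub>R w) ((- (inverse w * t * inverse w)) *\<^sub>R u))) (at w)" .
    then have "(f u has_derivative
        (\<lambda>t. w * G (u /\<^sub>R w) ((- (inverse w * t * inverse w)) *\<^sub>R u) + t * g (u /\<^sub>R w))) (at w)"
      unfolding f_def by (auto intro!: derivative_eq_intros)
    moreover have "w * G (u /\<^sub>R w) ((- (inverse w * t * inverse w)) *\<^sub>R u) + t * g (u /\<^sub>R w) =
        (g (u /\<^sub>R w) - G (u /\<^sub>R w) (u /\<^sub>R w)) * t" for t
      using that by (simp add: linear_cmul[OF lin_G] linear_neg[OF lin_G] field_simps)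
    ultimately show ?thesis by (simp add: has_field_derivative_def)
  qed
  have f_less: "f u v < f u w" if "0 < v" "v < w" for u v w
  proof (rule DERIV_pos_imp_increasing[OF that(2)])
    fix x
    assume "v \<le> x"
    then show "\<exists>y. (f u has_real_derivative y) (at x) \<and> 0 < y"
      using f'[of x u] that(1) rad[of "u /\<^sub>R x"] by (auto simp: G_def)
  qed
  have "\<exists>w>0. f u w = 1" for u
  proof -
    have "\<exists>w\<ge>1 / M. w \<le> 1 / c \<and> f u w = 1"
    proof (rule IVT')
      show "f u (1 / M) \<le> 1" "1 \<le> f u (1 / c)" "1 / M \<le> 1 / c"
        using M c M' by (auto simp: f_def field_simps frac_le)
      show "continuous_on {1 / M..1 / c} (f u)"
        using c M' by (intro continuous_at_imp_continuous_on ballI DERIV_isCont[OF f'])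
          (auto intro: less_le_trans[rotated])
    qed
    then show ?thesis using c M' by (meson divide_pos_pos less_le_trans zero_less_one)
  qed
  then obtain \<psi> where \<psi>: "0 < \<psi> u" "f u (\<psi> u) = 1" for u by metis
  have \<psi>_eq: "\<psi> u = w" if "0 < w" "f u w = 1" for u w
    using \<psi>[of u] that f_less[of w "\<psi> u" u] f_less[of "\<psi> u" w u]
    by (cases "\<psi> u" w rule: linorder_cases) auto
  define \<Phi> where "\<Phi> s = s /\<^sub>R g s" for s
  define r where "r u = u /\<^sub>R \<psi> u" for u
  have g_r: "g (r u) = 1 / \<psi> u" for u
    using \<psi>[of u] by (simp add: f_def r_def field_simps)
  have \<psi>_\<Phi>: "\<psi> (\<Phi> s) = 1 / g s" for s
    using g[of s] by (intro \<psi>_eq) (auto simp: f_def \<Phi>_def)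
  have r_\<Phi>: "r (\<Phi> s) = s" for s
    using g[of s] by (simp add: r_def \<psi>_\<Phi>) (simp add: \<Phi>_def)
  have \<Phi>_r: "\<Phi> (r u) = u" for u
    using \<psi>(1)[of u] by (simp add: \<Phi>_def g_r) (simp add: r_def)
  have \<Phi>': "(\<Phi> has_derivative (\<lambda>v. inverse (g s) *\<^sub>R v - (inverse (g s) * G s v * inverse (g s)) *\<^sub>R s)) (at s)" for s
    unfolding \<Phi>_def using G[of s] g[of s] by (auto intro!: derivative_eq_intros)
  \<comment> \<open>A kernel vector of the derivative of \<open>\<Phi>\<close> at \<open>s\<close> is a multiple of \<open>s\<close>, and on the line of \<open>s\<close>
    the derivative is multiplication by \<open>N s / (g s)\<^sup>2\<close>.\<close>
  have r_diff: "r differentiable (at u)" for u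
  proof -
    let ?s = "r u"
    define L where "L v = inverse (g ?s) *\<^sub>R v - (inverse (g ?s) * G ?s v * inverse (g ?s)) *\<^sub>R ?s" for v
    have L: "(\<Phi> has_derivative L) (at ?s)" using \<Phi>'[of ?s] by (simp add: L_def[abs_def])
    then have lin: "linear L" using has_derivative_linear by blast
    have "v = 0" if "L v = 0" for v
    proof -
      define l where "l = G ?s v / g ?s"
      have v: "v = l *\<^sub>R ?s"
      proof -
        have "v - l *\<^sub>R ?s = g ?s *\<^sub>R L v"
          using g[of ?s] by (simp add: L_def l_def scaleR_diff_right divide_inverse mult_ac)
        then show ?thesis using that by simp
      qed
      then have "G ?s v = l * G ?s ?s" by (metis linear_cmul[OF lin_G] real_scaleR_def)
      then have "l * (g ?s - G ?s ?s) = 0" using g[of ?s] by (simp add: l_def field_simps)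
      then have "l = 0" using rad[of ?s] by (simp add: G_def)
      then show "v = 0" using v by simp
    qed
    then have "inj L" using lin linear_injective_0 by blast
    then obtain K where K: "\<And>x. L (K x) = x"
      using linear_injective_isomorphism[OF lin] by blast
    have "(r has_derivative K) (at u)"
      by (rule has_derivative_inverse_strong_x[where S = UNIV and f = \<Phi> and f' = L])
         (use L K \<Phi>' r_\<Phi> \<Phi>_r in \<open>auto simp: fun_eq_iff intro!: has_derivative_continuous
            continuous_at_imp_continuous_on\<close>)
    then show ?thesis by (auto simp: differentiable_def)
  qed
  have \<psi>_diff: "\<psi> differentiable (at u)" for u
  proof -
    have "(\<lambda>u. g (r u)) differentiable (at u)"
      using r_diff[of u] G by (auto simp: differentiable_def intro: has_derivative_compose)
    then have "(\<lambda>u. inverse (g (r u))) differentiable (at u)"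
      using g[of "r u"] by (intro differentiable_inverse) auto
    then show ?thesis by (simp add: g_r)
  qed
  define N where "N s = g s - G s s" for s
  have N: "0 < N s" for s using rad by (simp add: N_def G_def)
  have \<psi>'_eq: "frechet_derivative \<psi> (at u) v = - G (r u) v / N (r u)" for u v
  proof -
    define D where "D = frechet_derivative \<psi> (at u)"
    have D: "(\<psi> has_derivative D) (at u)"
      using \<psi>_diff frechet_derivative_works by (auto simp: D_def)
    define w where "w = \<psi> u"
    have w: "0 < w" using \<psi> by (simp add: w_def)
    have "(r has_derivative (\<lambda>v. v /\<^sub>R w - (inverse w * D v * inverse w) *\<^sub>R u)) (at u)"
      unfolding r_def w_def using D \<psi>(1)[of u] by (auto intro!: derivative_eq_intros)
    from has_derivative_mult[OF D has_derivative_compose[OF this G]]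
    have "((\<lambda>u. \<psi> u * g (r u)) has_derivative
        (\<lambda>v. w * G (r u) (v /\<^sub>R w - (inverse w * D v * inverse w) *\<^sub>R u) + D v * g (r u))) (at u)"
      by (simp add: w_def)
    moreover have "((\<lambda>u. \<psi> u * g (r u)) has_derivative (\<lambda>v. 0)) (at u)"
    proof -
      have "\<psi> x * g (r x) = 1" for x
        using \<psi>(1)[of x] by (simp add: g_r)
      then show ?thesis by simp
    qed
    ultimately have "(\<lambda>v. w * G (r u) (v /\<^sub>R w - (inverse w * D v * inverse w) *\<^sub>R u) +
        D v * g (r u)) = (\<lambda>v. 0)"
      by (rule has_derivative_unique)
    then have "w * G (r u) (v /\<^sub>R w - (inverse w * D v * inverse w) *\<^sub>R u) + D v * g (r u) = 0"
      by (rule fun_cong)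
    moreover have "(inverse w * D v * inverse w) *\<^sub>R u = (inverse w * D v) *\<^sub>R r u"
      by (simp add: r_def w_def)
    ultimately have "w * G (r u) (v /\<^sub>R w - (inverse w * D v) *\<^sub>R r u) + D v * g (r u) = 0"
      by simp
    then have "w * (G (r u) v + D v * N (r u)) = 0"
      using w by (simp add: linear_diff[OF lin_G] linear_cmul[OF lin_G] N_def field_simps)
    then have "G (r u) v + D v * N (r u) = 0" using w by simp
    then show ?thesis using N[of "r u"] by (simp add: D_def[symmetric] field_simps)
  qed
  have \<psi>_Ck: "Ck_on k UNIV \<psi>" for k
  proof (induction k)
    case 0
    show ?case
      using \<psi>_diff by (auto intro!: continuous_at_imp_continuous_on differentiable_imp_continuous_within)
  next
    case (Suc k)
    have r_Ck: "Ck_on k UNIV (\<lambda>u. r u \<bullet> b)" for b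
    proof -
      have "Ck_on k UNIV (\<lambda>u. (u \<bullet> b) / \<psi> u)"
        using \<psi>(1) by (intro Ck_on_divide Suc Ck_on_linear bounded_linear_inner_left) (auto simp: less_le)
      then show ?thesis by (simp add: r_def divide_inverse mult.commute)
    qed
    have comp: "Ck_on k UNIV (\<lambda>u. p (r u))" if "Ck_on k UNIV p" for p
      by (rule Ck_on_compose[OF open_UNIV open_UNIV _ that r_Ck]) auto
    have "Ck_on k UNIV (\<lambda>u. G (r u) v)" for v
      by (rule comp) (unfold G_def, rule Ck_on_SucD(2)[OF Ck])
    moreover have "Ck_on k UNIV (\<lambda>u. N (r u))"
    proof (rule comp)
      have "Ck_on k UNIV (\<lambda>s. g s + (- 1) * frechet_derivative g (at s) s)"
        by (intro Ck_on_add Ck_on_mult Ck_on_const Ck_on_radial_derivative Ck open_UNIV)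
      then show "Ck_on k UNIV N" by (simp add: N_def[abs_def] G_def)
    qed
    ultimately have "Ck_on k UNIV (\<lambda>u. ((- 1) * G (r u) v) / N (r u))" for v
      using N by (intro Ck_on_divide Ck_on_mult Ck_on_const open_UNIV) (auto simp: less_le)
    then show ?case using \<psi>_diff by (simp add: \<psi>'_eq)
  qed
  have "0 < \<psi> u - frechet_derivative \<psi> (at u) u" for u
  proof -
    have "u = \<psi> u *\<^sub>R r u" using \<psi>(1)[of u] by (simp add: r_def)
    then have "G (r u) u = \<psi> u * G (r u) (r u)"
      by (metis linear_cmul[OF lin_G] real_scaleR_def)
    then have "\<psi> u - frechet_derivative \<psi> (at u) u = \<psi> u * g (r u) / N (r u)"
      using N[of "r u"] by (simp add: \<psi>'_eq N_def field_simps)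
    then show ?thesis using \<psi>(1)[of u] g[of "r u"] N[of "r u"] by simp
  qed
  with that \<psi>_Ck \<psi>(1) \<psi>_\<Phi> show ?thesis by (auto simp: \<Phi>_def)
qed

section \<open>Minkowski norms and their deformations\<close>

lemma minkowski_norm_zero:
  assumes "minkowski_norm F"
  shows "F 0 = 0"
proof -
  have "F (2 *\<^sub>R 0) = 2 * F 0" using assms unfolding minkowski_norm_def by (metis zero_less_numeral)
  then show ?thesis by simp
qed

text \<open>A zero of \<open>F\<close> at \<open>y\<close> is a zero on the whole open ray of \<open>y\<close>, and the fundamental form at \<open>y\<close>
  would vanish in the radial direction.\<close>

lemma minkowski_norm_pos:
  assumes "minkowski_norm F" "y \<noteq> 0"
  shows "0 < F y"
proof (rule ccontr)
  assume "\<not> 0 < F y"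
  then have "F y = 0" using assms by (auto simp: minkowski_norm_def order_antisym not_less)
  then have zero: "F (c *\<^sub>R y) = 0" if "0 < c" for c
    using assms that by (auto simp: minkowski_norm_def)
  have inner: "deriv (\<lambda>t. (F (y + s *\<^sub>R y + t *\<^sub>R y))\<^sup>2) 0 = 0" if "\<bar>s\<bar> < 1/2" for s
  proof -
    have "y + s *\<^sub>R y + t *\<^sub>R y = (1 + s + t) *\<^sub>R y" for t by (simp add: algebra_simps)
    then have "((\<lambda>t. (F (y + s *\<^sub>R y + t *\<^sub>R y))\<^sup>2) has_field_derivative 0) (at 0)"
      using that by (intro has_field_derivative_transform_within_open[OF DERIV_const, where S = "{-1/2<..<1/2}"])
        (auto simp: zero)
    then show ?thesis by (rule DERIV_imp_deriv)
  qed
  have "((\<lambda>s. deriv (\<lambda>t. (F (y + s *\<^sub>R y + t *\<^sub>R y))\<^sup>2) 0) has_field_derivative 0) (at 0)"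
    by (intro has_field_derivative_transform_within_open[OF DERIV_const, where S = "{-1/2<..<1/2}"])
       (auto simp: inner)
  then have "fundamental_form F y y y = 0"
    by (simp add: fundamental_form_def DERIV_imp_deriv)
  then show False using assms unfolding minkowski_norm_def by (metis less_irrefl)
qed

text \<open>The supremum in \<open>form_norm\<close> is a real one, so it bounds the quotients only because they are
  bounded: by homogeneity they take their values on the compact unit sphere, where \<open>F\<close> is continuous
  and positive.\<close>

lemma form_norm_upper:
  assumes "minkowski_norm F" "y \<noteq> 0"
  shows "\<bar>blinfun_apply \<beta> y\<bar> / F y \<le> form_norm F \<beta>"
proof -
  let ?S = "sphere (0 :: real^'a) 1"
  let ?q = "\<lambda>y. \<bar>blinfun_apply \<beta> y\<bar> / F y"
  obtain U h where "UNIV - {0} \<subseteq> U" "Ck_on 0 U h" "\<forall>x\<in>UNIV - {0}. h x = F x"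
    using assms(1) unfolding minkowski_norm_def smooth_on_def by blast
  then have "continuous_on (UNIV - {0}) F"
    by (simp cong: continuous_on_cong) (meson continuous_on_eq continuous_on_subset)
  then have "continuous_on ?S F"
    by (rule continuous_on_subset) auto
  moreover have "F x \<noteq> 0" if "x \<in> ?S" for x
    using minkowski_norm_pos[OF assms(1), of x] that by fastforce
  ultimately have "continuous_on ?S ?q"
    by (auto intro!: continuous_intros)
  then have "bounded (?q ` ?S)"
    by (intro compact_imp_bounded compact_continuous_image) auto
  then obtain B where "\<forall>z\<in>?q ` ?S. \<bar>z\<bar> \<le> B" unfolding bounded_real by blast
  then have B: "?q x \<le> B" if "x \<in> ?S" for x
    using that by (blast intro: abs_le_D1)
  have "?q x \<le> B" if "x \<noteq> 0" for x
  proof -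
    have "F (x /\<^sub>R norm x) = F x /\<^sub>R norm x"
      using assms(1) that unfolding minkowski_norm_def by (metis positive_imp_inverse_positive real_scaleR_def zero_less_norm_iff)
    then have "?q x = ?q (x /\<^sub>R norm x)"
      using that by (simp add: blinfun.scaleR_right abs_mult)
    then show ?thesis using B[of "x /\<^sub>R norm x"] that by simp
  qed
  then have "bdd_above (?q ` (UNIV - {0}))"
    by (auto intro!: bdd_aboveI)
  then show ?thesis
    unfolding form_norm_def using assms(2) by (intro cSUP_upper) auto
qed

lemma form_norm_nonneg:
  fixes F :: "real^'n::finite \<Rightarrow> real"
  assumes "minkowski_norm F"
  shows "0 \<le> form_norm F \<beta>"
proof -
  obtain y :: "real^'n" where y: "y \<noteq> 0" using zero_neq_one by metis
  have "0 \<le> \<bar>blinfun_apply \<beta> y\<bar> / F y"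
    using minkowski_norm_pos[OF assms y] by simp
  then show ?thesis using form_norm_upper[OF assms y] by (rule order_trans)
qed

text \<open>The path in the definition of \<open>partial_deriv\<close> stays in the box, so \<open>\<phi>\<close> can be replaced by its
  smooth extension \<open>h\<close>; as the interval is nondegenerate, the one-sided derivative at an end point
  is determined by \<open>h\<close> as well.\<close>

lemma partial_deriv_eq_frechet_derivative:
  fixes h :: "real^'n::finite \<Rightarrow> real"
  assumes s: "s \<in> form_box I \<delta>" and i: "i \<in> I" and \<delta>: "0 < \<delta> i"
    and eq: "\<And>x. x \<in> form_box I \<delta> \<Longrightarrow> \<phi> x = h x"
    and h: "h differentiable (at s)"
  shows "partial_deriv \<delta> \<phi> i s = frechet_derivative h (at s) (axis i 1)"
proof -
  let ?L = "\<lambda>t. \<chi> j. if j = i then t else s $ j"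
  let ?h' = "frechet_derivative h (at s)"
  have L: "?L t = s + (t - s $ i) *\<^sub>R axis i 1" for t
    by (auto simp: vec_eq_iff axis_def)
  have h': "(h has_derivative ?h') (at s)" using h by (simp add: frechet_derivative_works)
  have "(?L has_derivative (\<lambda>t. t *\<^sub>R axis i 1)) (at (s $ i) within {- \<delta> i..\<delta> i})"
    unfolding L by (auto intro!: derivative_eq_intros)
  moreover have "?L (s $ i) = s" by (simp add: L)
  ultimately have "((\<lambda>t. h (?L t)) has_derivative (\<lambda>t. ?h' (t *\<^sub>R axis i 1)))
      (at (s $ i) within {- \<delta> i..\<delta> i})"
    using has_derivative_compose[of ?L _ "s $ i" "{- \<delta> i..\<delta> i}" h ?h'] h' by simp
  then have "((\<lambda>t. h (?L t)) has_vector_derivative ?h' (axis i 1)) (at (s $ i) within {- \<delta> i..\<delta> i})"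
    using linear_cmul[OF has_derivative_linear[OF h']] by (simp add: has_vector_derivative_def)
  moreover have "h (?L t) = \<phi> (?L t)" if "t \<in> {- \<delta> i..\<delta> i}" for t
    using s that i by (intro eq[symmetric]) (auto simp: form_box_def)
  moreover have si: "s $ i \<in> {- \<delta> i..\<delta> i}" using s i by (auto simp: form_box_def)
  ultimately have "((\<lambda>t. \<phi> (?L t)) has_vector_derivative ?h' (axis i 1)) (at (s $ i) within {- \<delta> i..\<delta> i})"
    by (intro has_vector_derivative_transform[of "s $ i" "{- \<delta> i..\<delta> i}" "\<lambda>t. \<phi> (?L t)"
          "\<lambda>t. h (?L t)"]) auto
  then show ?thesis
    unfolding partial_deriv_def using vector_derivative_within_closed_interval[of "- \<delta> i" "\<delta> i" "s $ i"] si \<delta>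
    by auto
qed

lemma sum_partial_deriv:
  fixes h :: "real^'n::finite \<Rightarrow> real"
  assumes s: "s \<in> form_box I \<delta>" and \<delta>: "\<And>i. i \<in> I \<Longrightarrow> 0 < \<delta> i"
    and eq: "\<And>x. x \<in> form_box I \<delta> \<Longrightarrow> \<phi> x = h x"
    and h: "h differentiable (at s)"
  shows "(\<Sum>i\<in>I. s $ i * partial_deriv \<delta> \<phi> i s) = frechet_derivative h (at s) s"
proof -
  let ?h' = "frechet_derivative h (at s)"
  have lin: "linear ?h'" using h frechet_derivative_works has_derivative_linear by blast
  have "(\<Sum>i\<in>I. s $ i * partial_deriv \<delta> \<phi> i s) = (\<Sum>i\<in>I. s $ i * ?h' (axis i 1))"
    by (intro sum.cong refl) (simp add: partial_deriv_eq_frechet_derivative[OF s _ \<delta> eq h])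
  also have "\<dots> = (\<Sum>i\<in>UNIV. s $ i * ?h' (axis i 1))"
    using s by (intro sum.mono_neutral_left) (auto simp: form_box_def)
  also have "\<dots> = ?h' (\<Sum>i\<in>UNIV. s $ i *\<^sub>R axis i 1)"
    by (simp add: linear_sum[OF lin] linear_cmul[OF lin])
  also have "(\<Sum>i\<in>UNIV. s $ i *\<^sub>R axis i 1) = s"
    using basis_expansion[of s] by (simp add: scalar_mult_eq_scaleR)
  finally show ?thesis .
qed

text \<open>The quotients \<open>\<beta>/F\<close> lie in the box with half-widths \<open>form_norm F (\<beta> i)\<close>, where \<open>\<phi>\<close> agrees
  with its extension, so \<open>F'\<close> is also the deformation of \<open>F\<close> by the extension. Since \<open>\<psi>\<close> has the
  required properties on the whole space, any box whose half-widths exceed the norms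
  \<open>form_norm F' (\<beta> i)\<close> will do.\<close>

lemma deformation_inverse:
  assumes F: "minkowski_norm F" and F': "minkowski_norm F'"
    and adm: "admissible_deformation F I \<beta> \<delta> \<phi>"
    and F'_eq: "F' = deformation I \<beta> \<phi> F"
  obtains \<delta>' \<psi> where "admissible_deformation F' I \<beta> \<delta>' \<psi>" "F = deformation I \<beta> \<psi> F'"
proof -
  define a where "a i = form_norm F (\<beta> i)" for i
  have a: "0 \<le> a i" "a i < \<delta> i" if "i \<in> I" for i
    using adm that form_norm_nonneg[OF F] by (auto simp: a_def admissible_deformation_def)
  then have \<delta>: "0 < \<delta> i" if "i \<in> I" for i using that by (meson le_less_trans)
  obtain U h where U: "open U" "form_box I \<delta> \<subseteq> U" and h: "\<And>k. Ck_on k U h"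
    and eq: "\<And>x. x \<in> form_box I \<delta> \<Longrightarrow> \<phi> x = h x"
    using adm unfolding admissible_deformation_def smooth_on_def by metis
  have h_diff: "h differentiable (at s)" if "s \<in> form_box I \<delta>" for s
    using h[of "Suc 0"] U that by auto
  have "0 < h s" "0 < h s - frechet_derivative h (at s) s" if "s \<in> form_box I \<delta>" for s
    using adm that eq[OF that] sum_partial_deriv[OF that \<delta> eq h_diff[OF that]]
    unfolding admissible_deformation_def by auto
  then obtain g c M where g: "\<And>k. Ck_on k UNIV g" "0 < c" "\<And>s. c \<le> g s" "\<And>s. g s \<le> M"
    "\<And>s. 0 < g s - frechet_derivative g (at s) s"
    and g_eq: "\<And>s. s \<in> form_box I a \<Longrightarrow> g s = h s"
    using extend_deformation_function[of I a \<delta> U h] a U h by blast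
  obtain \<psi> where \<psi>: "\<And>k. Ck_on k UNIV \<psi>" "\<And>u. 0 < \<psi> u"
    "\<And>u. 0 < \<psi> u - frechet_derivative \<psi> (at u) u"
    and \<psi>_eq: "\<And>s. \<psi> (s /\<^sub>R g s) = 1 / g s"
    by (rule invert_deformation_function[OF g]) blast
  define \<delta>' where "\<delta>' i = form_norm F' (\<beta> i) + 1" for i
  have \<delta>': "0 < \<delta>' i" for i
    using form_norm_nonneg[OF F', of "\<beta> i"] by (simp add: \<delta>'_def)
  have "\<psi> differentiable (at s)" for s
    using \<psi>(1)[of "Suc 0"] by auto
  then have "0 < \<psi> s - (\<Sum>i\<in>I. s $ i * partial_deriv \<delta>' \<psi> i s)" if "s \<in> form_box I \<delta>'" for s
    using \<psi>(3)[of s] sum_partial_deriv[OF that \<delta>', of \<psi> \<psi>] by simp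
  then have "admissible_deformation F' I \<beta> \<delta>' \<psi>"
    using adm \<psi> unfolding admissible_deformation_def smooth_on_def
    by (auto simp: \<delta>'_def)
  moreover have "F y = deformation I \<beta> \<psi> F' y" for y
  proof (cases "y = 0")
    case True
    then show ?thesis
      by (simp add: deformation_def minkowski_norm_zero F F')
  next
    case False
    note pos = minkowski_norm_pos[OF F False]
    define s where "s = (\<chi> i. if i \<in> I then blinfun_apply (\<beta> i) y / F y else 0)"
    have "\<bar>s $ i\<bar> \<le> a i" if "i \<in> I" for i
      using form_norm_upper[OF F False, of "\<beta> i"] pos that by (simp add: s_def a_def)
    then have "s $ i \<in> {- a i..a i}" if "i \<in> I" for i
      using that by (simp add: abs_le_iff minus_le_iff)
    then have s: "s \<in> form_box I a"
      by (simp add: form_box_def) (simp add: s_def)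
    moreover have "form_box I a \<subseteq> form_box I \<delta>"
      using a(2) by (force simp: form_box_def)
    ultimately have "\<phi> s = g s" using eq g_eq by auto
    then have F'_y: "F' y = F y * g s"
      by (simp add: F'_eq deformation_def s_def)
    have "0 < g s" using g(2) g(3)[of s] by linarith
    moreover have "(\<chi> i. if i \<in> I then blinfun_apply (\<beta> i) y / F' y else 0) = s /\<^sub>R g s"
      by (auto simp: vec_eq_iff s_def F'_y divide_inverse)
    ultimately show ?thesis
      by (simp add: deformation_def \<psi>_eq F'_y)
  qed
  ultimately show ?thesis using that by blast
qed

section \<open>The equivalence relation\<close>

lemma deformation_equiv_refl:
  assumes "minkowski_norm F"
  shows "deformation_equiv p F F"
proof -
  have "admissible_deformation F {} \<beta> \<delta> (\<lambda>_. 1)" "F = deformation {} \<beta> (\<lambda>_. 1) F" for \<beta> \<delta>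
    by (auto simp: admissible_deformation_def smooth_on_def independent_empty deformation_def
        intro: Ck_on_const)
  then have "\<exists>I \<beta> \<delta> \<phi>. card I \<le> p \<and> admissible_deformation F I \<beta> \<delta> \<phi> \<and> F = deformation I \<beta> \<phi> F"
    by (metis card.empty le0)
  then show ?thesis
    unfolding deformation_equiv_def
    by (intro exI[of _ 1] exI[of _ "\<lambda>_. F"]) (use assms in auto)
qed

lemma deformation_equiv_sym:
  fixes F F' :: "real^'n::finite \<Rightarrow> real"
  assumes "deformation_equiv p F' F"
  shows "deformation_equiv p F F'"
proof -
  obtain m :: nat and Fs where m: "1 \<le> m" "Fs 0 = F" "Fs m = F'"
    and mink: "\<And>i. i \<le> m \<Longrightarrow> minkowski_norm (Fs i)"
    and step: "\<And>i. i \<in> {1..m} \<Longrightarrow> \<exists>I \<beta> \<delta> \<phi>. card I \<le> p \<and>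
      admissible_deformation (Fs (i - 1)) I \<beta> \<delta> \<phi> \<and> Fs i = deformation I \<beta> \<phi> (Fs (i - 1))"
    using assms unfolding deformation_equiv_def by blast
  have "\<exists>I \<beta> \<delta> \<phi>. card I \<le> p \<and> admissible_deformation (Fs (m - (i - 1))) I \<beta> \<delta> \<phi> \<and>
      Fs (m - i) = deformation I \<beta> \<phi> (Fs (m - (i - 1)))" if "i \<in> {1..m}" for i
  proof -
    define j where "j = m - (i - 1)"
    have j: "j \<in> {1..m}" "m - i = j - 1" using that by (auto simp: j_def)
    obtain I \<beta> \<delta> \<phi> where "card I \<le> p" "admissible_deformation (Fs (j - 1)) I \<beta> \<delta> \<phi>"
      "Fs j = deformation I \<beta> \<phi> (Fs (j - 1))"
      using step[OF j(1)] by blast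
    with deformation_inverse[of "Fs (j - 1)" "Fs j" I \<beta> \<delta> \<phi>] mink j show ?thesis
      unfolding j_def[symmetric] by (metis atLeastAtMost_iff diff_le_self order_trans)
  qed
  then show ?thesis
    unfolding deformation_equiv_def
    by (intro exI[of _ m] exI[of _ "\<lambda>i. Fs (m - i)"]) (use m mink in auto)
qed

lemma deformation_equiv_trans:
  fixes F F' F'' :: "real^'n::finite \<Rightarrow> real"
  assumes "deformation_equiv p F' F" "deformation_equiv p F'' F'"
  shows "deformation_equiv p F'' F"
proof -
  let ?step = "\<lambda>G G'. \<exists>I \<beta> \<delta> \<phi>. card I \<le> p \<and> admissible_deformation G I \<beta> \<delta> \<phi> \<and>
    G' = deformation I \<beta> \<phi> G"
  obtain m :: nat and Fs where m: "1 \<le> m" "Fs 0 = F" "Fs m = F'"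
    and F: "\<And>i. i \<le> m \<Longrightarrow> minkowski_norm (Fs i)"
      "\<And>i. i \<in> {1..m} \<Longrightarrow> ?step (Fs (i - 1)) (Fs i)"
    using assms(1) unfolding deformation_equiv_def by blast
  obtain n :: nat and Gs where n: "1 \<le> n" "Gs 0 = F'" "Gs n = F''"
    and G: "\<And>i. i \<le> n \<Longrightarrow> minkowski_norm (Gs i)"
      "\<And>i. i \<in> {1..n} \<Longrightarrow> ?step (Gs (i - 1)) (Gs i)"
    using assms(2) unfolding deformation_equiv_def by blast
  define Hs where "Hs i = (if i \<le> m then Fs i else Gs (i - m))" for i
  have Hs: "Hs i = Gs (i - m)" if "m \<le> i" for i
    using that m(3) n(2) by (cases "i = m") (auto simp: Hs_def)
  have "minkowski_norm (Hs i)" if "i \<le> m + n" for i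
    using that F(1) G(1) by (simp add: Hs_def)
  moreover have "?step (Hs (i - 1)) (Hs i)" if "i \<in> {1..m + n}" for i
  proof (cases "i \<le> m")
    case True
    then have "i - 1 \<le> m" by simp
    then show ?thesis using F(2)[of i] that True by (simp add: Hs_def)
  next
    case False
    then have "i - 1 - m = i - m - 1" "i - m \<in> {1..n}" using that by auto
    then show ?thesis using G(2)[of "i - m"] that False by (simp add: Hs)
  qed
  ultimately show ?thesis
    unfolding deformation_equiv_def
    by (intro exI[of _ "m + n"] exI[of _ Hs]) (use m n Hs in \<open>auto simp: Hs_def\<close>)
qed

theorem proposition6:
  fixes p :: nat
  assumes "1 < CARD('n::finite)" and "p \<le> CARD('n)"
  shows "equiv {F :: real^'n \<Rightarrow> real. minkowski_norm F}
           {(Fbar, F). deformation_equiv p Fbar F}"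
proof (rule equivI)
  have "minkowski_norm Fbar \<and> minkowski_norm F"
    if "deformation_equiv p Fbar F" for Fbar F :: "real^'n \<Rightarrow> real"
    using that unfolding deformation_equiv_def by (metis le0 order_refl)
  then show "{(Fbar, F :: real^'n \<Rightarrow> real). deformation_equiv p Fbar F}
      \<subseteq> {F. minkowski_norm F} \<times> {F. minkowski_norm F}"
    by auto
qed (auto simp: refl_on_def sym_def trans_def
      intro: deformation_equiv_refl deformation_equiv_sym deformation_equiv_trans)

end
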